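(* If a point set $X\subset\mathbb T^d$ is a lattice and the potential $f$ is decreasing and logarithmically convex on $(0,1/2]$, then $X$ is a local minimum of $E_F$.
   Context: $\mathbb T=\mathbb R/\mathbb Z$ is identified with $[0,1)$. A potential $f$ on $\mathbb T$ is viewed as a nonnegative even $1$-periodic function on $\mathbb R$, continuous on $(0,1)$. "Decreasing" means non-increasing; logarithmically convex means $f>0$ and $\log f$ is convex. Energy: $F(t_1,\dots,t_d)=f(t_1)\cdots f(t_d)$ and, for $X=\{\mathbf x^0,\dots,\mathbf x^{N-1}\}\subset\mathbb T^d$, $E_F(X)=\sum_{k,\ell=0,\,k\ne\ell}^{N-1}\prod_{i=1}^d f(x_i^k-x_i^\ell)$. A local minimum is understood for $E_F$ as a function of $(\mathbf x^0,\dots,\mathbf x^{N-1})\in(\mathbb T^d)^N$. Lattice: a set of the form $\left\{\left(\frac kN,\left\{\frac{h_2k}N\right\},\dots,\left\{\frac{h_dk}N\right\}\right):k=0,\dots,N-1\right\}$ with integers $h_i$ satisfying $\gcd(h_i,N)=1$ ($\{\cdot\}$ the fractional part). *)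

theory Defs
  imports "HOL-Analysis.Analysis"
begin

text \<open>The torus is identified with \<open>[0,1)\<close>; its points in dimension \<open>d\<close> have coordinates
  indexed by \<open>{1..d}\<close> (and are \<open>undefined\<close> elsewhere, so that sets of points have the
  right cardinality).\<close>

definition torus :: "nat \<Rightarrow> (nat \<Rightarrow> real) set" where
  "torus d = PiE {1..d} (\<lambda>_. {0..<1})"

text \<open>The quotient metric of \<open>\<real>/\<int>\<close>, i.e. the distance of \<open>s - t\<close> to the nearest integer.\<close>

definition circle_dist :: "real \<Rightarrow> real \<Rightarrow> real" where
  "circle_dist s t = infdist (s - t) \<int>"

text \<open>The value at the integers is an arbitrary nonnegative real.\<close>

definition potential :: "(real \<Rightarrow> real) \<Rightarrow> bool" where
  "potential f \<longleftrightarrow>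
     (\<forall>t. f t \<ge> 0) \<and> (\<forall>t. f (- t) = f t) \<and> (\<forall>t. f (t + 1) = f t) \<and> continuous_on {0<..<1} f"

definition log_convex_on :: "real set \<Rightarrow> (real \<Rightarrow> real) \<Rightarrow> bool" where
  "log_convex_on S f \<longleftrightarrow> (\<forall>t\<in>S. f t > 0) \<and> convex_on S (\<lambda>t. ln (f t))"

definition tensor_potential :: "nat \<Rightarrow> (real \<Rightarrow> real) \<Rightarrow> (nat \<Rightarrow> real) \<Rightarrow> real" where
  "tensor_potential d f t = (\<Prod>i=1..d. f (t i))"

definition energy :: "((nat \<Rightarrow> real) \<Rightarrow> real) \<Rightarrow> nat \<Rightarrow> (nat \<Rightarrow> nat \<Rightarrow> real) \<Rightarrow> real" where
  "energy F N x = (\<Sum>k<N. \<Sum>l\<in>{..<N} - {k}. F (\<lambda>i. x k i - x l i))"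

text \<open>Local minimality of a configuration \<open>(x 0, \<dots>, x (N - 1))\<close> in the \<open>N\<close>-fold product of
  the torus; the neighbourhoods are the balls of the maximum metric, which induces the
  product topology.\<close>

definition local_min_config ::
    "nat \<Rightarrow> ((nat \<Rightarrow> real) \<Rightarrow> real) \<Rightarrow> nat \<Rightarrow> (nat \<Rightarrow> nat \<Rightarrow> real) \<Rightarrow> bool" where
  "local_min_config d F N x \<longleftrightarrow>
     (\<forall>k<N. x k \<in> torus d) \<and>
     (\<exists>\<epsilon>>0. \<forall>y. (\<forall>k<N. y k \<in> torus d) \<longrightarrow>
        (\<forall>k<N. \<forall>i\<in>{1..d}. circle_dist (x k i) (y k i) < \<epsilon>) \<longrightarrow>
        energy F N x \<le> energy F N y)"

text \<open>A finite point set is a local minimum if it is one under every enumeration of its points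
  (the energy being symmetric, the choice of the enumeration is immaterial).\<close>

definition local_min_set ::
    "nat \<Rightarrow> ((nat \<Rightarrow> real) \<Rightarrow> real) \<Rightarrow> (nat \<Rightarrow> real) set \<Rightarrow> bool" where
  "local_min_set d F X \<longleftrightarrow>
     finite X \<and> (\<forall>x. bij_betw x {..<card X} X \<longrightarrow> local_min_config d F (card X) x)"

definition lattice_point :: "nat \<Rightarrow> nat \<Rightarrow> (nat \<Rightarrow> int) \<Rightarrow> nat \<Rightarrow> nat \<Rightarrow> real" where
  "lattice_point d N h k =
     (\<lambda>i\<in>{1..d}. if i = 1 then real k / real N else frac (real_of_int (h i) * real k / real N))"

definition is_lattice :: "nat \<Rightarrow> (nat \<Rightarrow> real) set \<Rightarrow> bool" where
  "is_lattice d X \<longleftrightarrow>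
     (\<exists>N h. N \<ge> 1 \<and> (\<forall>i\<in>{2..d}. gcd (h i) (int N) = 1) \<and> X = lattice_point d N h ` {..<N})"

end

theory Submission
  imports Defs
begin

text \<open>Evenness and periodicity make \<open>ln f\<close> locally convex at every non-integral
  \<open>t\<close> outside \<open>1/2 + \<int>\<close>, and \<open>f\<close> minimal at \<open>1/2\<close>; hence every non-integral \<open>t\<close> has a slope \<open>c\<close>
  with \<open>f (t + s) \<ge> f t * exp (c * s)\<close> for small \<open>s\<close>. Multiplying over the coordinates and using
  \<open>exp u \<ge> 1 + u\<close>, each term of the perturbed energy is bounded below by its unperturbed value plus
  a linear form in the displacements. In a lattice the difference of the \<open>k\<close>-th and \<open>l\<close>-th point
  depends only on \<open>k - l\<close> modulo \<open>N\<close>, and so do the coefficients of these linear forms; summed over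
  all pairs they cancel.\<close>

section \<open>Supporting exponentials of the potential\<close>

lemma potential_plus_of_int:
  assumes "potential f"
  shows "f (t + of_int n) = f t"
proof -
  interpret periodic_fun_simple' f
    using assms by unfold_locales (simp add: potential_def)
  show ?thesis by (rule plus_of_int)
qed

text \<open>A convex function has a supporting line at every interior point; exponentiating the one
  of \<open>ln f\<close> gives the bound.\<close>

lemma log_convex_on_support:
  assumes "log_convex_on S f" "t \<in> interior S"
  shows "\<exists>c. \<exists>\<eta>>0. \<forall>s. \<bar>s\<bar> < \<eta> \<longrightarrow> f t * exp (c * s) \<le> f (t + s)"
proof -
  have pos: "\<And>u. u \<in> S \<Longrightarrow> f u > 0" and conv: "convex_on S (\<lambda>u. ln (f u))"
    using assms(1) by (auto simp: log_convex_on_def)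
  obtain \<eta> where \<eta>: "\<eta> > 0" "ball t \<eta> \<subseteq> S"
    using assms(2) by (auto simp: mem_interior)
  obtain c where c: "\<And>u. u \<in> S \<Longrightarrow> ln (f u) \<ge> ln (f t) + c * (u - t)"
    using convex_le_Inf_differential[OF conv assms(2)] by blast
  have tS: "t \<in> S"
    using assms(2) interior_subset by blast
  have "f t * exp (c * s) \<le> f (t + s)" if "\<bar>s\<bar> < \<eta>" for s
  proof -
    have S: "t + s \<in> S"
      using \<eta>(2) that by (auto simp: dist_norm subset_iff)
    have "f t * exp (c * s) = exp (ln (f t) + c * s)"
      using pos[OF tS] by (simp add: exp_add)
    also have "\<dots> \<le> exp (ln (f (t + s)))"
      using c[OF S] by simp
    finally show ?thesis
      using pos[OF S] by simp
  qed
  then show ?thesis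
    using \<eta>(1) by blast
qed

text \<open>Integer translation reduces to the interval from 0 to 1, and reflection about 1/2 to its
  left half, where convexity covers all but the endpoint 1/2.\<close>

lemma potential_support:
  assumes "potential f" "antimono_on {0<..1/2} f" "log_convex_on {0<..1/2} f"
    and "t \<notin> \<int>"
  shows "\<exists>c. \<exists>\<eta>>0. \<forall>s. \<bar>s\<bar> < \<eta> \<longrightarrow> f t * exp (c * s) \<le> f (t + s)"
proof -
  have refl: "f (1 - u) = f u" for u
  proof -
    have "f (1 - u) = f (- u + 1)" by (simp add: algebra_simps)
    also have "\<dots> = f u" using assms(1) unfolding potential_def by metis
    finally show ?thesis .
  qed
  have left: "\<exists>c. \<exists>\<eta>>0. \<forall>s. \<bar>s\<bar> < \<eta> \<longrightarrow> f u * exp (c * s) \<le> f (u + s)"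
    if "0 < u" "u < 1/2" for u
  proof (rule log_convex_on_support[OF assms(3)])
    have "{0<..<1/2} \<subseteq> interior {0<..1/2::real}"
      by (rule interior_maximal) auto
    then show "u \<in> interior {0<..1/2}"
      using that by auto
  qed
  have unit: "\<exists>c. \<exists>\<eta>>0. \<forall>s. \<bar>s\<bar> < \<eta> \<longrightarrow> f u * exp (c * s) \<le> f (u + s)"
    if u: "0 < u" "u < 1" for u
  proof -
    consider "u < 1/2" | "u = 1/2" | "u > 1/2" by linarith
    then show ?thesis
    proof cases
      case 1
      then show ?thesis using left u by simp
    next
      \<comment> \<open>Being an endpoint of the interval of convexity, 1/2 is handled by
        monotonicity: \<open>f\<close> is minimal there, so slope 0 works.\<close>
      case 2
      have "f (1/2) \<le> f (1/2 + s)" if "\<bar>s\<bar> < 1/2" for s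
      proof (cases "s \<le> 0")
        case True
        show ?thesis
          by (rule monotone_onD[OF assms(2)]) (use True that in auto)
      next
        case False
        have "f (1/2) \<le> f (1/2 - s)"
          by (rule monotone_onD[OF assms(2)]) (use False that in auto)
        also have "\<dots> = f (1/2 + s)"
          using refl[of "1/2 - s"] by (simp add: algebra_simps)
        finally show ?thesis .
      qed
      then show ?thesis
        unfolding 2 by (intro exI[of _ 0] exI[of _ "1/2"]) auto
    next
      case 3
      obtain c \<eta> where \<eta>: "\<eta> > 0"
        and c: "\<And>s. \<bar>s\<bar> < \<eta> \<Longrightarrow> f (1 - u) * exp (c * s) \<le> f (1 - u + s)"
        using left[of "1 - u"] 3 u by auto
      \<comment> \<open>Reflection reverses displacements and hence the sign of the slope.\<close>
      have "f u * exp (- c * s) \<le> f (u + s)" if "\<bar>s\<bar> < \<eta>" for s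
        using c[of "- s"] that refl[of u] refl[of "u + s"] by (simp add: algebra_simps)
      then show ?thesis
        using \<eta> by blast
    qed
  qed
  have "0 < frac t" "frac t < 1"
    using assms(4) by (simp_all add: frac_lt_1)
  from unit[OF this] obtain c \<eta> where \<eta>: "\<eta> > 0"
    and c: "\<And>s. \<bar>s\<bar> < \<eta> \<Longrightarrow> f (frac t) * exp (c * s) \<le> f (frac t + s)"
    by blast
  have "f (frac t + s) = f (t + s)" for s
    using potential_plus_of_int[OF assms(1), of "frac t + s" "\<lfloor>t\<rfloor>"]
    by (simp add: frac_def algebra_simps)
  from this c this[of 0] show ?thesis
    using \<eta> by auto
qed

section \<open>Circulant sums\<close>

text \<open>Congruent numbers below \<open>N\<close> are equal, so both maps are injective on a
  finite set. They run along a row and down a column of a circulant matrix.\<close>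

lemma bij_betw_diff_mod:
  "bij_betw (\<lambda>l. nat ((m - int l) mod int N)) {..<N} {..<N}"
  "bij_betw (\<lambda>l. nat ((int l - m) mod int N)) {..<N} {..<N}"
proof -
  have bij: "bij_betw g {..<N} {..<N}"
    if "inj_on g {..<N}" "g ` {..<N} \<subseteq> {..<N}" for g :: "nat \<Rightarrow> nat"
    using that endo_inj_surj[of "{..<N}" g] by (simp add: bij_betw_def)
  have eq: "k = l" if "k < N" "l < N" "int N dvd int k - int l" for k l
    using that by (metis mod_eq_dvd_iff mod_less zmod_int of_nat_eq_iff)
  show "bij_betw (\<lambda>l. nat ((m - int l) mod int N)) {..<N} {..<N}"
  proof (rule bij)
    show "inj_on (\<lambda>l. nat ((m - int l) mod int N)) {..<N}"
    proof (rule inj_onI)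
      fix k l assume "k \<in> {..<N}" "l \<in> {..<N}"
        and "nat ((m - int k) mod int N) = nat ((m - int l) mod int N)"
      then have kl: "k < N" "l < N" "(m - int k) mod int N = (m - int l) mod int N"
        by (auto simp: nat_eq_iff2)
      then have "int N dvd (m - int k) - (m - int l)"
        by (simp only: mod_eq_dvd_iff)
      then show "k = l" using eq[of l k] kl by simp
    qed
  qed (auto simp: nat_less_iff)
  show "bij_betw (\<lambda>l. nat ((int l - m) mod int N)) {..<N} {..<N}"
  proof (rule bij)
    show "inj_on (\<lambda>l. nat ((int l - m) mod int N)) {..<N}"
    proof (rule inj_onI)
      fix k l assume "k \<in> {..<N}" "l \<in> {..<N}"
        and "nat ((int k - m) mod int N) = nat ((int l - m) mod int N)"
      then have kl: "k < N" "l < N" "(int k - m) mod int N = (int l - m) mod int N"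
        by (auto simp: nat_eq_iff2)
      then have "int N dvd (int k - m) - (int l - m)"
        by (simp only: mod_eq_dvd_iff)
      then show "k = l" using eq[of k l] kl by simp
    qed
  qed (auto simp: nat_less_iff)
qed

text \<open>Up to the permutation \<open>\<sigma>\<close> the coefficients form a circulant matrix,
  so every row sum and every column sum equals the sum of \<open>a\<close>. Row sums multiply
  \<open>\<delta> k\<close>, column sums \<open>\<delta> l\<close>, and the two totals
  agree.\<close>

lemma sum_circulant_diff_eq_0:
  fixes a \<delta> :: "nat \<Rightarrow> real"
  assumes "bij_betw \<sigma> {..<N} {..<N}"
  shows "(\<Sum>k<N. \<Sum>l\<in>{..<N} - {k}.
    a (nat ((int (\<sigma> k) - int (\<sigma> l)) mod int N)) * (\<delta> k - \<delta> l)) = 0"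
proof -
  define A where "A k l = a (nat ((int (\<sigma> k) - int (\<sigma> l)) mod int N))" for k l
  have row: "(\<Sum>l<N. A k l) = (\<Sum>j<N. a j)" for k
    unfolding A_def
    using sum.reindex_bij_betw[OF assms, of "\<lambda>l. a (nat ((int (\<sigma> k) - int l) mod int N))"]
      sum.reindex_bij_betw[OF bij_betw_diff_mod(1), of a "int (\<sigma> k)" N] by simp
  have col: "(\<Sum>k<N. A k l) = (\<Sum>j<N. a j)" for l
    unfolding A_def
    using sum.reindex_bij_betw[OF assms, of "\<lambda>k. a (nat ((int k - int (\<sigma> l)) mod int N))"]
      sum.reindex_bij_betw[OF bij_betw_diff_mod(2), of a "int (\<sigma> l)" N] by simp
  \<comment> \<open>The diagonal may be included whatever \<open>a 0\<close> is: its factor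
    \<open>\<delta> k - \<delta> k\<close> vanishes.\<close>
  have "(\<Sum>k<N. \<Sum>l\<in>{..<N} - {k}. A k l * (\<delta> k - \<delta> l)) = (\<Sum>k<N. \<Sum>l<N. A k l * (\<delta> k - \<delta> l))"
    by (intro sum.cong sum.mono_neutral_left) auto
  also have "\<dots> = (\<Sum>k<N. \<Sum>l<N. A k l * \<delta> k) - (\<Sum>k<N. \<Sum>l<N. A k l * \<delta> l)"
    by (simp add: right_diff_distrib sum_subtractf)
  also have "(\<Sum>k<N. \<Sum>l<N. A k l * \<delta> l) = (\<Sum>l<N. \<Sum>k<N. A k l * \<delta> l)"
    by (rule sum.swap)
  also have "(\<Sum>k<N. \<Sum>l<N. A k l * \<delta> k) - (\<Sum>l<N. \<Sum>k<N. A k l * \<delta> l) = 0"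
    by (simp add: sum_distrib_right[symmetric] row col)
  finally show ?thesis
    by (simp add: A_def)
qed

section \<open>Displacements on the circle and lattice coordinates\<close>

text \<open>If the infimum is below \<open>\<epsilon>\<close>, so is the distance to some integer.
  The real displacement \<open>\<delta>\<close> is what the linear estimates need.\<close>

lemma circle_dist_less_imp:
  assumes "circle_dist s t < \<epsilon>"
  obtains n \<delta> where "t = s + of_int n + \<delta>" "\<bar>\<delta>\<bar> < \<epsilon>"
proof -
  have "\<exists>z\<in>\<int>. dist (s - t) z < \<epsilon>"
    using assms unfolding circle_dist_def infdist_def
    by (auto simp: cINF_less_iff split: if_splits)
  then obtain n where "dist (s - t) (of_int n) < \<epsilon>"
    by (auto elim: Ints_cases)
  then show thesis
    by (intro that[of "- n" "t - s + of_int n"]) (auto simp: dist_real_def)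
qed

text \<open>Otherwise \<open>N\<close> would divide \<open>h * j\<close> and, by coprimality,
  \<open>j\<close>. So no coordinate of a difference of distinct lattice points hits the integers,
  where \<open>f\<close> is uncontrolled.\<close>

lemma lattice_coordinate_not_Int:
  fixes h :: int and j N :: nat
  assumes "gcd h (int N) = 1" "0 < j" "j < N"
  shows "of_int h * real j / real N \<notin> \<int>"
proof
  assume "of_int h * real j / real N \<in> \<int>"
  then obtain z where "of_int h * real j / real N = of_int z"
    by (auto elim: Ints_cases)
  then have "of_int h * real j = of_int z * real N"
    using assms by (simp add: field_simps)
  then have "real_of_int (h * int j) = real_of_int (z * int N)"
    by simp
  then have "h * int j = z * int N"
    by (simp only: of_int_eq_iff)
  then have "int N dvd h * int j"
    by simp
  moreover have "coprime (int N) h"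
    using assms(1) by (simp add: coprime_iff_gcd_eq_1 gcd.commute)
  ultimately have "int N dvd int j"
    by (simp add: coprime_dvd_mult_right_iff)
  then show False
    using assms(2,3) by (simp add: dvd_imp_le leD)
qed

section \<open>The energy near a lattice configuration\<close>

text \<open>Allowing coordinates up to integers and an arbitrary numbering \<open>\<sigma>\<close>
  treats the first coordinate, the fractional parts and all enumerations uniformly.\<close>

lemma lattice_config_local_min:
  fixes H :: "nat \<Rightarrow> int"
  assumes f: "potential f" "antimono_on {0<..1/2} f" "log_convex_on {0<..1/2} f"
    and H: "\<And>i. i \<in> {1..d} \<Longrightarrow> gcd (H i) (int N) = 1"
    and \<sigma>: "bij_betw \<sigma> {..<N} {..<N}"
    and torus: "\<And>k. k < N \<Longrightarrow> x k \<in> torus d"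
    and x: "\<And>k i. k < N \<Longrightarrow> i \<in> {1..d} \<Longrightarrow>
      \<exists>n. x k i = of_int (H i) * real (\<sigma> k) / real N + of_int n"
  shows "local_min_config d (tensor_potential d f) N x"
proof -
  \<comment> \<open>\<open>t i j\<close> is a coordinate of the \<open>j\<close>-th lattice point
    before reduction modulo 1; \<open>J k l\<close> is the index of the lattice point that equals
    the difference of points \<open>k\<close> and \<open>l\<close> modulo 1.\<close>
  define t where "t i j = of_int (H i) * real j / real N" for i j
  define J where "J k l = nat ((int (\<sigma> k) - int (\<sigma> l)) mod int N)" for k l
  have "\<exists>c. \<exists>\<eta>>0. \<forall>s. \<bar>s\<bar> < \<eta> \<longrightarrow> f (t i j) * exp (c * s) \<le> f (t i j + s)"
    if "i \<in> {1..d}" "j \<in> {0<..<N}" for i j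
    unfolding t_def using potential_support[OF f lattice_coordinate_not_Int] H that by auto
  then obtain c \<eta> where \<eta>: "\<And>i j. i \<in> {1..d} \<Longrightarrow> j \<in> {0<..<N} \<Longrightarrow> \<eta> i j > (0::real)"
    and c: "\<And>i j s. i \<in> {1..d} \<Longrightarrow> j \<in> {0<..<N} \<Longrightarrow> \<bar>s\<bar> < \<eta> i j \<Longrightarrow>
      f (t i j) * exp (c i j * s) \<le> f (t i j + s)"
    by metis
  \<comment> \<open>The element 1 keeps the set nonempty when there are no pairs; the half is there
    because two points each moved by less than \<open>\<epsilon>\<close> change their difference by
    less than \<open>2 * \<epsilon>\<close>.\<close>
  define \<epsilon> where "\<epsilon> = Min (insert 1 ((\<lambda>(i, j). \<eta> i j) ` ({1..d} \<times> {0<..<N}))) / 2"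
  have "\<epsilon> > 0"
    unfolding \<epsilon>_def using \<eta> by (subst half_gt_zero_iff) (subst Min_gr_iff, auto)
  have \<epsilon>_le: "2 * \<epsilon> \<le> \<eta> i j" if "i \<in> {1..d}" "j \<in> {0<..<N}" for i j
    unfolding \<epsilon>_def using that by (auto intro!: Min_le)
  define p where "p j = (\<Prod>i=1..d. f (t i j))" for j
  have nonneg: "f u \<ge> 0" for u
    using f(1) by (simp add: potential_def)
  then have p_nonneg: "p j \<ge> 0" for j
    unfolding p_def by (simp add: prod_nonneg)
  have J_range: "J k l \<in> {0<..<N}" if "k < N" "l < N" "k \<noteq> l" for k l
  proof -
    have lt: "\<sigma> k < N" "\<sigma> l < N" and ne: "\<sigma> k \<noteq> \<sigma> l"
      using \<sigma> that unfolding bij_betw_def inj_on_def by auto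
    have "(int (\<sigma> k) - int (\<sigma> l)) mod int N \<noteq> 0"
    proof
      assume "(int (\<sigma> k) - int (\<sigma> l)) mod int N = 0"
      then have "int (\<sigma> k) mod int N = int (\<sigma> l) mod int N"
        by (simp add: mod_eq_dvd_iff mod_0_imp_dvd)
      then show False
        using lt ne by simp
    qed
    moreover have "0 \<le> (int (\<sigma> k) - int (\<sigma> l)) mod int N" "(int (\<sigma> k) - int (\<sigma> l)) mod int N < int N"
      using that by simp_all
    ultimately show ?thesis
      unfolding J_def by (simp add: nat_less_iff)
  qed
  \<comment> \<open>Periodicity absorbs all integers at once: those in the coordinates, those from
    the displacements, and \<open>H i * q\<close> from reducing the index modulo
    \<open>N\<close>.\<close>
  have shift: "f (x k i + of_int a + u - (x l i + of_int b + v)) = f (t i (J k l) + (u - v))"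
    if kli: "k < N" "l < N" "i \<in> {1..d}" for k l i a b u v
  proof -
    obtain m where m: "x k i = of_int (H i) * real (\<sigma> k) / real N + of_int m"
      using x[OF kli(1,3)] by blast
    obtain n where n: "x l i = of_int (H i) * real (\<sigma> l) / real N + of_int n"
      using x[OF kli(2,3)] by blast
    define q where "q = (int (\<sigma> k) - int (\<sigma> l)) div int N"
    have "int (J k l) = int (\<sigma> k) - int (\<sigma> l) - q * int N"
      unfolding J_def q_def using that(1) by (simp add: minus_div_mult_eq_mod)
    then have "real (J k l) = real (\<sigma> k) - real (\<sigma> l) - of_int q * real N"
      by (metis of_int_diff of_int_mult of_int_of_nat_eq)
    then have "real (\<sigma> k) = real (J k l) + real (\<sigma> l) + of_int q * real N"
      by simp
    then have "x k i + of_int a + u - (x l i + of_int b + v)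
        = t i (J k l) + (u - v) + of_int (m - n + a - b + H i * q)"
      unfolding m n t_def using that(1) by (simp add: add_divide_distrib distrib_left)
    then show ?thesis
      by (simp only: potential_plus_of_int[OF f(1)])
  qed
  have "energy (tensor_potential d f) N x \<le> energy (tensor_potential d f) N y"
    if y: "\<forall>k<N. \<forall>i\<in>{1..d}. circle_dist (x k i) (y k i) < \<epsilon>" for y
  proof -
    have "\<exists>n \<delta>. y k i = x k i + of_int n + \<delta> \<and> \<bar>\<delta>\<bar> < \<epsilon>" if "k < N" "i \<in> {1..d}" for k i
      using y that by (meson circle_dist_less_imp)
    then obtain n \<delta> where \<delta>: "\<And>k i. k < N \<Longrightarrow> i \<in> {1..d} \<Longrightarrow> y k i = x k i + of_int (n k i) + \<delta> k i"
      "\<And>k i. k < N \<Longrightarrow> i \<in> {1..d} \<Longrightarrow> \<bar>\<delta> k i\<bar> < \<epsilon>"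
      by metis
    have Fx: "tensor_potential d f (\<lambda>i. x k i - x l i) = p (J k l)" if "k < N" "l < N" for k l
      unfolding tensor_potential_def p_def
      using shift[OF that, of _ 0 0 0 0] by (intro prod.cong) auto
    have Fy: "p (J k l) + (\<Sum>i=1..d. p (J k l) * c i (J k l) * (\<delta> k i - \<delta> l i))
        \<le> tensor_potential d f (\<lambda>i. y k i - y l i)" if kl: "k < N" "l < N" "k \<noteq> l" for k l
    proof -
      let ?j = "J k l" and ?u = "\<lambda>i. c i (J k l) * (\<delta> k i - \<delta> l i)"
      have "p ?j + (\<Sum>i=1..d. p ?j * c i ?j * (\<delta> k i - \<delta> l i)) = p ?j * (1 + (\<Sum>i=1..d. ?u i))"
        by (simp add: distrib_left sum_distrib_left mult.assoc)
      also have "\<dots> \<le> p ?j * exp (\<Sum>i=1..d. ?u i)"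
        by (intro mult_left_mono exp_ge_add_one_self p_nonneg)
      also have "\<dots> = (\<Prod>i=1..d. f (t i ?j) * exp (?u i))"
        by (simp add: p_def exp_sum prod.distrib)
      also have "\<dots> \<le> (\<Prod>i=1..d. f (y k i - y l i))"
      proof (intro prod_mono conjI mult_nonneg_nonneg nonneg exp_ge_zero)
        fix i assume i: "i \<in> {1..d}"
        have "\<bar>\<delta> k i - \<delta> l i\<bar> < 2 * \<epsilon>"
          using \<delta>(2)[OF kl(1) i] \<delta>(2)[OF kl(2) i] by linarith
        then have "f (t i ?j) * exp (?u i) \<le> f (t i ?j + (\<delta> k i - \<delta> l i))"
          using c[OF i J_range[OF kl]] \<epsilon>_le[OF i J_range[OF kl]] by simp
        then show "f (t i ?j) * exp (?u i) \<le> f (y k i - y l i)"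
          by (simp only: \<delta>(1)[OF kl(1) i] \<delta>(1)[OF kl(2) i] shift[OF kl(1,2) i])
      qed
      finally show ?thesis
        by (simp add: tensor_potential_def)
    qed
    \<comment> \<open>The coordinate sum moves outward in two swaps, as the range of
      \<open>l\<close> depends on \<open>k\<close>.\<close>
    have "(\<Sum>k<N. \<Sum>l\<in>{..<N} - {k}. \<Sum>i=1..d. p (J k l) * c i (J k l) * (\<delta> k i - \<delta> l i))
        = (\<Sum>k<N. \<Sum>i=1..d. \<Sum>l\<in>{..<N} - {k}. p (J k l) * c i (J k l) * (\<delta> k i - \<delta> l i))"
      by (intro sum.cong refl sum.swap)
    also have "\<dots> = (\<Sum>i=1..d. \<Sum>k<N. \<Sum>l\<in>{..<N} - {k}. p (J k l) * c i (J k l) * (\<delta> k i - \<delta> l i))"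
      by (rule sum.swap)
    also have "\<dots> = 0"
    proof (rule sum.neutral, intro ballI)
      \<comment> \<open>The slope \<open>c i 0\<close> is unconstrained, but index 0 arises only on
        the excluded diagonal.\<close>
      fix i
      show "(\<Sum>k<N. \<Sum>l\<in>{..<N} - {k}. p (J k l) * c i (J k l) * (\<delta> k i - \<delta> l i)) = 0"
        unfolding J_def
        by (rule sum_circulant_diff_eq_0[OF \<sigma>, of "\<lambda>j. p j * c i j" "\<lambda>k. \<delta> k i"])
    qed
    finally have lin: "(\<Sum>k<N. \<Sum>l\<in>{..<N} - {k}. \<Sum>i=1..d.
      p (J k l) * c i (J k l) * (\<delta> k i - \<delta> l i)) = 0" .
    have "energy (tensor_potential d f) N x = (\<Sum>k<N. \<Sum>l\<in>{..<N} - {k}. p (J k l))"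
      unfolding energy_def by (intro sum.cong refl Fx) auto
    also have "\<dots> = (\<Sum>k<N. \<Sum>l\<in>{..<N} - {k}. p (J k l) +
        (\<Sum>i=1..d. p (J k l) * c i (J k l) * (\<delta> k i - \<delta> l i)))"
      by (simp only: sum.distrib lin add_0_right)
    also have "\<dots> \<le> energy (tensor_potential d f) N y"
      unfolding energy_def by (intro sum_mono Fy) auto
    finally show ?thesis .
  qed
  then show ?thesis
    unfolding local_min_config_def using \<open>\<epsilon> > 0\<close> torus by blast
qed

section \<open>From configurations to point sets\<close>

theorem corollary4p4:
  fixes d :: nat and f :: "real \<Rightarrow> real" and X :: "(nat \<Rightarrow> real) set"
  assumes "d \<ge> 1"
    and "potential f"
    and "antimono_on {0<..1/2} f"
    and "log_convex_on {0<..1/2} f"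
    and "X \<subseteq> torus d"
    and "is_lattice d X"
  shows "local_min_set d (tensor_potential d f) X"
proof -
  obtain N h where N: "N \<ge> 1" and h: "\<forall>i\<in>{2..d}. gcd (h i) (int N) = 1"
    and X: "X = lattice_point d N h ` {..<N}"
    using assms(6) by (auto simp: is_lattice_def)
  let ?L = "lattice_point d N h"
  \<comment> \<open>The first coordinate \<open>k / N\<close> determines \<open>k\<close>, so
    \<open>X\<close> has exactly \<open>N\<close> points and its enumerations have length
    \<open>N\<close>.\<close>
  have "inj_on ?L {..<N}"
  proof (rule inj_onI)
    fix k l assume "?L k = ?L l"
    then have "?L k 1 = ?L l 1" by simp
    then show "k = l"
      using N assms(1) by (simp add: lattice_point_def)
  qed
  then have L: "bij_betw ?L {..<N} X"
    by (simp add: X bij_betw_def)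
  then have card: "card X = N"
    using bij_betw_same_card by fastforce
  \<comment> \<open>The first coordinate fits the common form with multiplier 1, which is coprime to
    \<open>N\<close>.\<close>
  define H where "H i = (if i = 1 then 1 else h i)" for i
  have "local_min_config d (tensor_potential d f) N x" if x: "bij_betw x {..<N} X" for x
  proof (rule lattice_config_local_min[OF assms(2-4)])
    \<comment> \<open>The given enumeration is compared with the standard one: \<open>x k\<close> is
      lattice point number \<open>?\<sigma> k\<close>.\<close>
    let ?\<sigma> = "inv_into {..<N} ?L \<circ> x"
    show "gcd (H i) (int N) = 1" if "i \<in> {1..d}" for i
      using h that by (auto simp: H_def)
    show "bij_betw ?\<sigma> {..<N} {..<N}"
      using x bij_betw_inv_into[OF L] by (rule bij_betw_trans)
    show "x k \<in> torus d" if "k < N" for k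
      using that x assms(5) bij_betwE by blast
    show "\<exists>n. x k i = of_int (H i) * real (?\<sigma> k) / real N + of_int n"
      if "k < N" "i \<in> {1..d}" for k i
    proof -
      have "x k \<in> X"
        using that x bij_betwE by blast
      then have "x k i = ?L (?\<sigma> k) i"
        using L by (simp add: bij_betw_inv_into_right)
      then show ?thesis
        using that
        by (cases "i = 1")
          (auto simp: H_def lattice_point_def frac_def intro: exI[of _ 0]
            intro!: exI[of _ "- \<lfloor>of_int (h i) * real (?\<sigma> k) / real N\<rfloor>"])
    qed
  qed
  then show ?thesis
    by (simp add: local_min_set_def card) (simp add: X)
qed

end
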